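(* Let $\lambda_0>0$, $l\in\mathbb{R}_{\le 0}\cup\{-\infty\}$, $u\in\mathbb{R}_{\ge 0}\cup\{+\infty\}$, let $\Psi=\{\psi_n\}_{n\in[N]}$ be a family of generating functions as in the context, let $\beta_{\psi_n}^{l,u}:[l,u]\to\mathbb{R}$ and $\kappa_n^\pm$ be as defined in the context, and let $\rho>0$ and $n\in[N]$. Then for every $x\in\mathbb{R}$ the (set-valued) proximal operator of $\rho\beta_{\psi_n}^{l,u}$ is given by $$\mathrm{prox}_{\rho\beta_{\psi_n}^{l,u}}(x)=\operatorname*{argmin}_{v\in[l,u]\cap\mathcal{V}(x)}\left\{\beta_{\psi_n}^{l,u}(v)+\frac{1}{2\rho}(v-x)^2\right\},$$ where $\mathcal{V}(x)=\{l,0,x,u\}\cup S_x$ and $$S_x=\{v\in\mathbb{R}:\ v-\rho\,\psi_n'(v)=x-\rho\,\kappa_n^{\pm}\},$$ i.e. $S_x$ is the set of $v$ for which the equation holds with $\kappa_n^+$ or with $\kappa_n^-$.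
   Context: Notation: $[N]=\{1,\dots,N\}$; $[l,u]$ is understood as a subset of $\mathbb{R}$ (infinite endpoints mean the corresponding constraint is absent, and infinite elements of $\{l,0,x,u\}$ are discarded by intersection with $[l,u]$). Generating functions: each $\psi_n$ is strictly convex, proper and twice differentiable, with $\mathrm{dom}(\psi_n)\in\{\mathbb{R},\mathbb{R}_{\ge 0}\}$ and $[l,u]\subseteq\mathrm{dom}(\psi_n)$. Let $d_{\psi_n}(x,z)=\psi_n(x)-\psi_n(z)-\psi_n'(z)(x-z)$, and let $\alpha_n^-\le 0\le\alpha_n^+$ be such that $[\alpha_n^-,\alpha_n^+]$ is the $\lambda_0$-sublevel set $\{z:\ d_{\psi_n}(0,z)\le\lambda_0\}$. Set $\eta_n^-=\max\{\alpha_n^-,l\}$ and $\eta_n^+=\min\{\alpha_n^+,u\}$. When $l\ne 0$, $\kappa_n^-=\psi_n'(\alpha_n^-)$ if $\alpha_n^-\ge l$ and $\kappa_n^-=l^{-1}(\lambda_0+\psi_n(l)-\psi_n(0))$ if $\alpha_n^-<l$. When $u\neq 0$, $\kappa_n^+=\psi_n'(\alpha_n^+)$ if $\alpha_n^+\le u$ and $\kappa_n^+=u^{-1}(\lambda_0+\psi_n(u)-\psi_n(0))$ if $\alpha_n^+>u$. (If $l=0$, resp. $u=0$, then $\kappa_n^-$, resp. $\kappa_n^+$, plays no role and the corresponding equation in $S_x$ is omitted.) The function $\beta_{\psi_n}^{l,u}$ is defined on $[l,u]$ by $\beta_{\psi_n}^{l,u}(0)=0$ and $$\beta_{\psi_n}^{l,u}(x)=\begin{cases}\psi_n(0)-\psi_n(x)+\kappa_n^-x,&x\in(\eta_n^-,0],\\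 \psi_n(0)-\psi_n(x)+\kappa_n^+x,&x\in[0,\eta_n^+),\\ \lambda_0,&x\in[l,u]\setminus\big((\eta_n^-,\eta_n^+)\cup\{0\}\big).\end{cases}$$ The proximal operator, which includes the box constraint, is the set $$\mathrm{prox}_{\rho\beta_{\psi_n}^{l,u}}(x)=\operatorname*{argmin}_{v\in[l,u]}\left\{\beta_{\psi_n}^{l,u}(v)+\frac{1}{2\rho}(v-x)^2\right\}.$$ *)

theory Defs
  imports "HOL-Analysis.Analysis"
begin

section \<open>Generating functions\<close>

definition eff_dom :: "(real \<Rightarrow> ereal) \<Rightarrow> real set" where
  "eff_dom \<psi> = {x. \<psi> x < \<infinity>}"

definition proper_fun :: "(real \<Rightarrow> ereal) \<Rightarrow> bool" where
  "proper_fun \<psi> \<longleftrightarrow> (\<forall>x. \<psi> x \<noteq> -\<infinity>) \<and> eff_dom \<psi> \<noteq> {}"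

definition strictly_convex :: "(real \<Rightarrow> ereal) \<Rightarrow> bool" where
  "strictly_convex \<psi> \<longleftrightarrow> convex (eff_dom \<psi>) \<and>
     (\<forall>x\<in>eff_dom \<psi>. \<forall>y\<in>eff_dom \<psi>. \<forall>t. x \<noteq> y \<and> 0 < t \<and> t < 1 \<longrightarrow>
        \<psi> ((1 - t) * x + t * y) < ereal (1 - t) * \<psi> x + ereal t * \<psi> y)"

text \<open>The finite values of \<open>\<psi>\<close> as reals; only meaningful on \<open>eff_dom \<psi>\<close>.\<close>

definition fin_val :: "(real \<Rightarrow> ereal) \<Rightarrow> real \<Rightarrow> real" where
  "fin_val \<psi> x = real_of_ereal (\<psi> x)"

text \<open>The derivative is taken relative to the domain, so at the boundary point 0 of the domain
  \<open>{0..}\<close> it is the right derivative, if that exists (it does not for \<open>x * ln x\<close>).\<close>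

definition gderiv :: "(real \<Rightarrow> ereal) \<Rightarrow> real \<Rightarrow> real" where
  "gderiv \<psi> z = vector_derivative (fin_val \<psi>) (at z within eff_dom \<psi>)"

text \<open>Differentiability is only demanded in the interior of the domain, to admit functions
  like \<open>x * ln x\<close> on \<open>{0..}\<close>.\<close>

definition twice_diff :: "(real \<Rightarrow> ereal) \<Rightarrow> bool" where
  "twice_diff \<psi> \<longleftrightarrow> (\<forall>z\<in>interior (eff_dom \<psi>).
     fin_val \<psi> differentiable (at z) \<and> gderiv \<psi> differentiable (at z))"

text \<open>The real points between two extended-real bounds.\<close>

definition ebox :: "ereal \<Rightarrow> ereal \<Rightarrow> real set" where
  "ebox l u = {v. l \<le> ereal v \<and> ereal v \<le> u}"

definition generating_fun :: "ereal \<Rightarrow> ereal \<Rightarrow> (real \<Rightarrow> ereal) \<Rightarrow> bool" where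
  "generating_fun l u \<psi> \<longleftrightarrow> strictly_convex \<psi> \<and> proper_fun \<psi> \<and> twice_diff \<psi> \<and>
     eff_dom \<psi> \<in> {UNIV, {0..}} \<and> ebox l u \<subseteq> eff_dom \<psi>"

text \<open>For \<open>x = z = 0\<close> this is 0 even if \<open>\<psi>\<close> has no derivative at 0, since the last factor
  vanishes.\<close>

definition bregman :: "(real \<Rightarrow> ereal) \<Rightarrow> real \<Rightarrow> real \<Rightarrow> real" where
  "bregman \<psi> x z = fin_val \<psi> x - fin_val \<psi> z - gderiv \<psi> z * (x - z)"

text \<open>\<open>\<alpha>m\<close>, \<open>\<alpha>p\<close> are the end points of the sublevel set of \<open>d\<^sub>\<psi>(0, \<cdot>)\<close>. They may be infinite:
  for \<open>\<psi> = exp\<close> the sublevel set is unbounded below as soon as \<open>lam0 \<ge> 1\<close>.\<close>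

definition sublevel_ends :: "real \<Rightarrow> (real \<Rightarrow> ereal) \<Rightarrow> ereal \<Rightarrow> ereal \<Rightarrow> bool" where
  "sublevel_ends lam0 \<psi> \<alpha>m \<alpha>p \<longleftrightarrow> \<alpha>m \<le> 0 \<and> 0 \<le> \<alpha>p \<and>
     {z \<in> eff_dom \<psi>. bregman \<psi> 0 z \<le> lam0} = ebox \<alpha>m \<alpha>p"


section \<open>The relaxation \<open>\<beta>\<close>\<close>

text \<open>\<open>\<psi>'\<close> at an extended-real point; at infinity it is the limit of \<open>\<psi>'\<close>.\<close>

definition gderiv_ext :: "(real \<Rightarrow> ereal) \<Rightarrow> ereal \<Rightarrow> real" where
  "gderiv_ext \<psi> a = (case a of ereal r \<Rightarrow> gderiv \<psi> r
     | PInfty \<Rightarrow> Lim at_top (gderiv \<psi>)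
     | MInfty \<Rightarrow> Lim at_bot (gderiv \<psi>))"

text \<open>In the second branches below \<open>l\<close> and \<open>u\<close> are necessarily finite, as \<open>\<alpha>m < l \<le> 0\<close> and
  \<open>0 \<le> u < \<alpha>p\<close>. The values of \<open>\<kappa>m\<close> for \<open>l = 0\<close> and of \<open>\<kappa>p\<close> for \<open>u = 0\<close> are never used.\<close>

definition \<kappa>m :: "real \<Rightarrow> (real \<Rightarrow> ereal) \<Rightarrow> ereal \<Rightarrow> ereal \<Rightarrow> real" where
  "\<kappa>m lam0 \<psi> \<alpha>m l =
     (if l \<le> \<alpha>m then gderiv_ext \<psi> \<alpha>m
      else (lam0 + fin_val \<psi> (real_of_ereal l) - fin_val \<psi> 0) / real_of_ereal l)"

definition \<kappa>p :: "real \<Rightarrow> (real \<Rightarrow> ereal) \<Rightarrow> ereal \<Rightarrow> ereal \<Rightarrow> real" where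
  "\<kappa>p lam0 \<psi> \<alpha>p u =
     (if \<alpha>p \<le> u then gderiv_ext \<psi> \<alpha>p
      else (lam0 + fin_val \<psi> (real_of_ereal u) - fin_val \<psi> 0) / real_of_ereal u)"

text \<open>A total function, only meaningful on \<open>ebox l u\<close>.\<close>

definition \<beta> ::
  "real \<Rightarrow> (real \<Rightarrow> ereal) \<Rightarrow> ereal \<Rightarrow> ereal \<Rightarrow> ereal \<Rightarrow> ereal \<Rightarrow> real \<Rightarrow> real" where
  "\<beta> lam0 \<psi> \<alpha>m \<alpha>p l u x =
     (if x = 0 then 0
      else if max \<alpha>m l < ereal x \<and> x \<le> 0 then fin_val \<psi> 0 - fin_val \<psi> x + \<kappa>m lam0 \<psi> \<alpha>m l * x
      else if 0 \<le> x \<and> ereal x < min \<alpha>p u then fin_val \<psi> 0 - fin_val \<psi> x + \<kappa>p lam0 \<psi> \<alpha>p u * x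
      else lam0)"


section \<open>Proximal operator\<close>

definition argmin_set :: "('a \<Rightarrow> real) \<Rightarrow> 'a set \<Rightarrow> 'a set" where
  "argmin_set f A = {v. is_arg_min f (\<lambda>w. w \<in> A) v}"

definition prox_obj :: "real \<Rightarrow> (real \<Rightarrow> real) \<Rightarrow> real \<Rightarrow> real \<Rightarrow> real" where
  "prox_obj \<rho> g x v = g v + 1 / (2 * \<rho>) * (v - x)\<^sup>2"

text \<open>The proximal operator of \<open>\<rho> g\<close>, including the box constraint.\<close>

definition prox :: "real \<Rightarrow> (real \<Rightarrow> real) \<Rightarrow> ereal \<Rightarrow> ereal \<Rightarrow> real \<Rightarrow> real set" where
  "prox \<rho> g l u x = argmin_set (prox_obj \<rho> g x) (ebox l u)"

text \<open>The solutions of \<open>v - \<rho> \<psi>'(v) = x - \<rho> \<kappa>\<close>, among the points where \<open>\<psi>'(v)\<close> exists.\<close>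

definition stat_pts :: "real \<Rightarrow> (real \<Rightarrow> ereal) \<Rightarrow> real \<Rightarrow> real \<Rightarrow> real set" where
  "stat_pts \<rho> \<psi> \<kappa> x =
     {v \<in> eff_dom \<psi>. fin_val \<psi> differentiable (at v within eff_dom \<psi>) \<and>
        v - \<rho> * gderiv \<psi> v = x - \<rho> * \<kappa>}"

definition S_set ::
  "real \<Rightarrow> real \<Rightarrow> (real \<Rightarrow> ereal) \<Rightarrow> ereal \<Rightarrow> ereal \<Rightarrow> ereal \<Rightarrow> ereal \<Rightarrow> real \<Rightarrow> real set" where
  "S_set \<rho> lam0 \<psi> \<alpha>m \<alpha>p l u x =
     (if l = 0 then {} else stat_pts \<rho> \<psi> (\<kappa>m lam0 \<psi> \<alpha>m l) x) \<union>
     (if u = 0 then {} else stat_pts \<rho> \<psi> (\<kappa>p lam0 \<psi> \<alpha>p u) x)"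

text \<open>Infinite elements of \<open>{l, 0, x, u}\<close> are dropped.\<close>

definition V_set ::
  "real \<Rightarrow> real \<Rightarrow> (real \<Rightarrow> ereal) \<Rightarrow> ereal \<Rightarrow> ereal \<Rightarrow> ereal \<Rightarrow> ereal \<Rightarrow> real \<Rightarrow> real set" where
  "V_set \<rho> lam0 \<psi> \<alpha>m \<alpha>p l u x =
     {v. ereal v \<in> {l, 0, ereal x, u}} \<union> S_set \<rho> lam0 \<psi> \<alpha>m \<alpha>p l u x"

end

theory Submission
  imports Defs
begin

text \<open>
  On each side of 0 convexity gives \<open>0 \<le> \<beta> \<le> lam0\<close>, and the choice of \<open>\<kappa>\<close> makes \<open>\<beta>\<close> continuous away
  from 0. Since \<open>\<beta> 0 = 0\<close> is the least value, the objective is lower semicontinuous and coercive, so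
  it has a minimizer on the closed box, and it suffices to see that every minimizer \<open>v\<close> lies in
  \<open>V_set\<close>. If \<open>\<beta> v = lam0\<close>, the maximal value, then \<open>v\<close> must be the point of the box nearest to \<open>x\<close>,
  i.e. one of \<open>l\<close>, \<open>x\<close>, \<open>u\<close>. Otherwise \<open>v = 0\<close>, or \<open>\<beta>\<close> is differentiable near \<open>v\<close> and the vanishing
  derivative is the equation defining \<open>S_set\<close>.
\<close>

section \<open>Bounds and continuity of the relaxation on one half-line\<close>

text \<open>
  One side of \<open>\<beta>\<close>, to be applied to \<open>\<psi>\<close> and to its reflection \<open>\<lambda>z. \<psi> (- z)\<close>. Here \<open>f\<close> may be
  discontinuous at 0, with \<open>f 0\<close> above its right limit.
\<close>

locale half_line_relaxation =
  fixes f f' :: "real \<Rightarrow> real" and lam0 \<kappa> :: real and A U :: ereal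
  assumes convex: "convex_on {0..} f"
    and deriv: "0 < z \<Longrightarrow> (f has_real_derivative f' z) (at z)"
    and cont_deriv: "continuous_on {0<..} f'"
    and lam0_pos: "0 < lam0"
    and A_nonneg: "0 \<le> A" and U_nonneg: "0 \<le> U"
    and sublevel: "0 < z \<Longrightarrow> f 0 - f z + f' z * z \<le> lam0 \<longleftrightarrow> ereal z \<le> A"
    and kappa_A: "A \<le> U \<Longrightarrow> A = ereal r \<Longrightarrow> \<kappa> = f' r"
    and kappa_inf: "A = \<infinity> \<Longrightarrow> U = \<infinity> \<Longrightarrow> (f' \<longlongrightarrow> L) at_top \<Longrightarrow> \<kappa> = L"
    and kappa_U: "U < A \<Longrightarrow> U = ereal r \<Longrightarrow> 0 < r \<Longrightarrow> \<kappa> = (lam0 + f r - f 0) / r"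
begin

text \<open>Stands for \<open>\<beta>\<close> on the open half-line only: at 0 it equals
  \<open>lam0\<close> instead of 0 when \<open>min A U = 0\<close>.\<close>

definition b :: "real \<Rightarrow> real" where
  "b z = (if ereal z < min A U then f 0 - f z + \<kappa> * z else lam0)"

lemma tangent:
  assumes "0 < z" "0 \<le> y"
  shows "f z + f' z * (y - z) \<le> f y"
proof -
  have "f y - f z \<ge> f' z * (y - z)"
    using assms
    by (intro convex_on_imp_above_tangent[OF convex])
      (auto intro: has_field_derivative_at_within deriv convex_connected)
  then show ?thesis by simp
qed

lemma deriv_mono:
  assumes "0 < y" "y \<le> z"
  shows "f' y \<le> f' z"
proof (cases "y = z")
  case False
  \<comment> \<open>Adding the tangent inequalities at \<open>z\<close> and at \<open>y\<close>
    cancels the values of \<open>f\<close>.\<close>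
  have "f z + f' z * (y - z) \<le> f y" "f y + f' y * (z - y) \<le> f z"
    using assms by (auto intro: tangent)
  then have "(z - y) * f' y \<le> (z - y) * f' z" by (simp add: algebra_simps)
  then show ?thesis using False assms by simp
qed simp

text \<open>The slopes increase, and an unbounded sublevel set forces them to be bounded, so they
  converge to their supremum, which is therefore \<open>\<kappa>\<close>.\<close>

lemma deriv_tendsto_kappa:
  assumes "A = \<infinity>" "U = \<infinity>"
  shows "(f' \<longlongrightarrow> \<kappa>) at_top" and "0 < z \<Longrightarrow> f' z \<le> \<kappa>"
proof -
  define L where "L = (SUP z\<in>{0<..}. f' z)"
  \<comment> \<open>Adding the tangent inequality at \<open>z\<close>, evaluated at 1, to the
    sublevel inequality at \<open>z\<close> leaves a single \<open>f' z\<close>.\<close>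
  have "f' z \<le> f 1 + lam0 - f 0" if "0 < z" for z
    using tangent[OF that, of 1] sublevel[OF that] assms by (simp add: algebra_simps)
  then have bdd: "bdd_above (f' ` {0<..})"
    by (intro bdd_aboveI2) auto
  have le: "f' z \<le> L" if "0 < z" for z
    unfolding L_def using that by (intro cSUP_upper bdd) auto
  have lim: "(f' \<longlongrightarrow> L) at_top"
  proof (rule order_tendstoI)
    fix a assume "a < L"
    then obtain y where y: "0 < y" "a < f' y"
      unfolding L_def by (subst (asm) less_cSUP_iff[OF _ bdd]) auto
    then show "\<forall>\<^sub>F z in at_top. a < f' z"
      using deriv_mono by (intro eventually_at_top_linorderI[of y]) (meson less_le_trans)
  next
    fix a assume "L < a"
    then show "\<forall>\<^sub>F z in at_top. f' z < a"
      using le by (intro eventually_at_top_linorderI[of 1]) (meson le_less_trans less_le_trans zero_less_one)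
  qed
  show "(f' \<longlongrightarrow> \<kappa>) at_top" "0 < z \<Longrightarrow> f' z \<le> \<kappa>"
    using kappa_inf[OF assms lim] lim le by auto
qed

text \<open>Here \<open>\<kappa>\<close> is the slope at \<open>A\<close>, or its limit. The lower
  bound follows from \<open>f' z \<le> \<kappa>\<close> and the tangent at \<open>z\<close>
  evaluated at 0. For the upper bound, the tangent at a point \<open>w\<close> between
  \<open>z\<close> and \<open>A\<close> bounds the expression with slope \<open>f' w\<close> by its
  value at \<open>w\<close>, which the sublevel condition bounds by \<open>lam0\<close>.\<close>

lemma linear_bounds_A:
  assumes "A \<le> U" "0 < z" "ereal z < A"
  shows "0 \<le> f 0 - f z + \<kappa> * z" "f 0 - f z + \<kappa> * z \<le> lam0"
proof -
  have upper: "f 0 - f z + f' w * z \<le> lam0" if "z \<le> w" "ereal w \<le> A" for w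
    using tangent[of w z] sublevel[of w] that assms by (simp add: algebra_simps)
  have "f' z \<le> \<kappa> \<and> f 0 - f z + \<kappa> * z \<le> lam0"
  proof (cases A)
    case (real r)
    then have "\<kappa> = f' r" using kappa_A assms by simp
    then show ?thesis using upper[of r] deriv_mono[of z r] assms real by simp
  next
    case PInf
    then have inf: "A = \<infinity>" "U = \<infinity>" using assms by auto
    \<comment> \<open>No point \<open>w\<close> has slope \<open>\<kappa>\<close> by definition
      here, so the upper bound is passed to the limit in \<open>w\<close>.\<close>
    have "((\<lambda>w. f 0 - f z + f' w * z) \<longlongrightarrow> f 0 - f z + \<kappa> * z) at_top"
      by (intro tendsto_intros deriv_tendsto_kappa inf)
    then have "f 0 - f z + \<kappa> * z \<le> lam0"
      by (rule tendsto_upperbound)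
        (auto intro!: eventually_at_top_linorderI[of z] upper simp: inf)
    then show ?thesis using deriv_tendsto_kappa(2) inf assms by simp
  qed (use A_nonneg in auto)
  moreover have "f z \<le> f 0 + f' z * z" using tangent[of z 0] assms by simp
  moreover have "f' z * z \<le> \<kappa> * z"
    using calculation(1) assms by (intro mult_right_mono) auto
  ultimately show "0 \<le> f 0 - f z + \<kappa> * z" "f 0 - f z + \<kappa> * z \<le> lam0" by linarith+
qed

text \<open>If the end is \<open>A\<close>, the sublevel inequality holds at \<open>r\<close> and
  fails to the right of it, so continuity of \<open>f'\<close> turns it into an equality. If the end
  is \<open>U\<close>, the chord formula for \<open>\<kappa>\<close> is exactly this
  equation.\<close>

lemma linear_at_end:
  assumes "0 < r" "min A U = ereal r"
  shows "f 0 - f r + \<kappa> * r = lam0"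
proof (cases "A \<le> U")
  case True
  then have A: "A = ereal r" using assms by (simp add: min_def)
  have "isCont f' r"
    using cont_deriv assms by (auto simp: continuous_on_eq_continuous_at)
  moreover have "isCont f r" using deriv[OF assms(1)] by (rule DERIV_isCont)
  ultimately have "isCont (\<lambda>z. f 0 - f z + f' z * z) r"
    by (intro continuous_intros)
  then have "((\<lambda>z. f 0 - f z + f' z * z) \<longlongrightarrow> f 0 - f r + f' r * r) (at_right r)"
    unfolding isCont_def by (rule tendsto_within_subset) auto
  moreover have "\<forall>\<^sub>F z in at_right r. lam0 \<le> f 0 - f z + f' z * z"
    unfolding eventually_at_right_field
  proof (intro exI[of _ "r + 1"] conjI allI impI)
    fix z assume "r < z" "z < r + 1"
    then show "lam0 \<le> f 0 - f z + f' z * z" using sublevel[of z] A assms by simp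
  qed simp
  ultimately have "lam0 \<le> f 0 - f r + f' r * r"
    by (rule tendsto_lowerbound) simp
  then show ?thesis
    using sublevel[of r] assms A kappa_A[OF True A] by simp
next
  case False
  then have "U = ereal r" using assms by (simp add: min_def)
  then show ?thesis using kappa_U[of r] False assms by (simp add: not_le)
qed

lemma b_bounds:
  assumes "0 < z"
  shows "0 \<le> b z" "b z \<le> lam0"
proof -
  have "0 \<le> f 0 - f z + \<kappa> * z \<and> f 0 - f z + \<kappa> * z \<le> lam0" if "ereal z < min A U"
  proof (cases "A \<le> U")
    case True
    then show ?thesis using linear_bounds_A[of z] assms that by simp
  next
    \<comment> \<open>Now \<open>f r = f 0 + \<kappa> * r - lam0\<close>. The chord of
      \<open>f\<close> from 0 to \<open>r\<close> gives the lower bound on the relaxation. Since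
      \<open>r\<close> lies in the sublevel set, \<open>f' r \<le> \<kappa>\<close>, and the tangent
      at \<open>r\<close> gives the upper bound.\<close>
    case False
    then obtain r where r: "U = ereal r" using U_nonneg by (cases U) auto
    then have zr: "z < r" using that by simp
    have eq: "f r = f 0 + \<kappa> * r - lam0"
      using linear_at_end[of r] False r zr assms by (simp add: min_def)
    have "f ((1 - z / r) *\<^sub>R 0 + (z / r) *\<^sub>R r) \<le> (1 - z / r) * f 0 + (z / r) * f r"
      using assms zr by (intro convex_onD[OF convex]) auto
    then have "f z \<le> (1 - z / r) * f 0 + (z / r) * (f 0 + \<kappa> * r - lam0)"
      using assms zr by (simp add: eq)
    also have "\<dots> = f 0 + \<kappa> * z - z / r * lam0"
      using assms zr by (simp add: field_simps)
    also have "\<dots> \<le> f 0 + \<kappa> * z" using assms zr lam0_pos by simp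
    finally have lower: "f z \<le> f 0 + \<kappa> * z" .
    have "f 0 - f r + f' r * r \<le> lam0"
      using sublevel[of r] False r zr assms by simp
    then have "f' r * r \<le> \<kappa> * r" using eq by simp
    then have "f' r \<le> \<kappa>" using zr assms by simp
    then have "f' r * (r - z) \<le> \<kappa> * (r - z)"
      using zr by (intro mult_right_mono) auto
    moreover have "f r + f' r * (z - r) \<le> f z" using assms zr by (intro tangent) auto
    ultimately show ?thesis using lower eq by (simp add: algebra_simps)
  qed
  then show "0 \<le> b z" "b z \<le> lam0" using lam0_pos by (simp_all add: b_def)
qed

lemma continuous_on_b: "continuous_on {0<..} b"
proof -
  have cont: "continuous_on {0<..} (\<lambda>z. f 0 - f z + \<kappa> * z)"
    by (intro continuous_intros)
      (auto intro!: continuous_at_imp_continuous_on dest: deriv[THEN DERIV_isCont])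
  consider "min A U = \<infinity>" | "min A U = 0" | r where "0 < r" "min A U = ereal r"
    using A_nonneg U_nonneg by (cases "min A U") (force simp: min_def split: if_splits)+
  then show ?thesis
  proof cases
    case 1
    then show ?thesis using cont by (simp add: b_def[abs_def])
  next
    case 2
    then show ?thesis by (auto simp: b_def cong: continuous_on_cong_simp)
  next
    case 3
    \<comment> \<open>The gluing rule takes closed pieces, whereas \<open>b\<close> tests strictly;
      both formulas equal \<open>lam0\<close> at \<open>r\<close>, so the two versions
      agree.\<close>
    have "continuous_on {0<..} (\<lambda>z. if z \<le> r then f 0 - f z + \<kappa> * z else lam0)"
      using linear_at_end[OF 3]
      by (intro continuous_on_cases_le continuous_intros continuous_on_subset[OF cont]) auto
    also have "?this \<longleftrightarrow> ?thesis"
      using linear_at_end[OF 3] 3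
      by (intro continuous_on_cong) (auto simp: b_def less_le)
    finally show ?thesis .
  qed
qed

end

section \<open>Existence of minimizers and reduction to a subset\<close>

text \<open>A minimizer over \<open>T\<close> lies in \<open>S\<close> and so fixes the same least
  value for both sets. Without existence over \<open>T\<close>, its argmin would be empty while
  \<open>S\<close> could still have a minimizer.\<close>

lemma argmin_set_eq_subset:
  assumes "S \<subseteq> T" "\<And>v. is_arg_min g (\<lambda>w. w \<in> T) v \<Longrightarrow> v \<in> S"
    and "\<exists>v. is_arg_min (g :: _ \<Rightarrow> real) (\<lambda>w. w \<in> T) v"
  shows "argmin_set g T = argmin_set g S"
proof -
  obtain m where m: "m \<in> S" "\<And>w. w \<in> T \<Longrightarrow> g m \<le> g w"
    using assms(2,3) by (auto simp: is_arg_min_linorder)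
  have "v \<in> argmin_set g T" if "v \<in> argmin_set g S" for v
    using that m assms(1) unfolding argmin_set_def is_arg_min_linorder by (auto intro: order_trans)
  moreover have "v \<in> argmin_set g S" if "v \<in> argmin_set g T" for v
    using that assms(1,2) unfolding argmin_set_def by (auto simp: is_arg_min_linorder)
  ultimately show ?thesis by blast
qed

text \<open>\<open>g\<close> may jump at 0. If 0 is not a minimizer, then neither is any point near 0, because the
  quadratic part alone is already too large there; what remains is compact and \<open>g\<close> is continuous
  on it.\<close>

lemma prox_obj_attains_min:
  fixes g :: "real \<Rightarrow> real"
  assumes "closed C" "0 \<in> C" "0 < \<rho>" "g 0 = 0" "\<And>v. v \<in> C \<Longrightarrow> 0 \<le> g v"
    and contp: "continuous_on (C \<inter> {0<..}) g" and contn: "continuous_on (C \<inter> {..<0}) g"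
  shows "\<exists>v. is_arg_min (prox_obj \<rho> g x) (\<lambda>w. w \<in> C) v"
proof (cases "\<forall>w\<in>C. prox_obj \<rho> g x 0 \<le> prox_obj \<rho> g x w")
  case True
  then show ?thesis using assms by (auto simp: is_arg_min_linorder)
next
  case False
  then obtain w where w: "w \<in> C" "prox_obj \<rho> g x w < prox_obj \<rho> g x 0" by force
  define q where "q v = 1 / (2 * \<rho>) * (v - x)\<^sup>2" for v
  have q_le: "q v \<le> prox_obj \<rho> g x v" if "v \<in> C" for v
    using assms(5)[OF that] by (simp add: prox_obj_def q_def)
  have q0: "prox_obj \<rho> g x 0 = q 0" using assms by (simp add: prox_obj_def q_def)
  have "isCont q 0" unfolding q_def by (intro continuous_intros) (use assms in auto)
  \<comment> \<open>At 0 the objective equals \<open>q 0\<close>, which exceeds the value at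
    \<open>w\<close>; continuity of \<open>q\<close> extends this to a neighbourhood.\<close>
  then have "\<forall>\<^sub>F v in nhds 0. prox_obj \<rho> g x w < q v"
    using w q0 by (auto simp: isCont_def tendsto_at_iff_tendsto_nhds elim: order_tendstoD)
  then obtain d where d: "0 < d" "\<And>v. \<bar>v\<bar> < d \<Longrightarrow> prox_obj \<rho> g x w < q v"
    unfolding eventually_nhds_metric by (auto simp: dist_real_def)
  \<comment> \<open>The ball about \<open>x\<close> through 0 is the set where \<open>q\<close> is
    at most \<open>q 0\<close>. Removing \<open>\<bar>v\<bar> < d\<close> leaves two compact pieces,
    one on each side of the possible jump.\<close>
  define Kp where "Kp = C \<inter> cball x \<bar>x\<bar> \<inter> {d..}"
  define Kn where "Kn = C \<inter> cball x \<bar>x\<bar> \<inter> {..-d}"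
  have K: "closed Kp" "closed Kn" "compact (Kp \<union> Kn)"
    unfolding Kp_def Kn_def using assms
    by (auto intro!: compact_Un closed_Int compact_Int_closed closed_Int_compact[OF \<open>closed C\<close>])
  have far: "q 0 < q v" if "v \<notin> cball x \<bar>x\<bar>" for v
  proof -
    have "\<bar>x\<bar> < \<bar>v - x\<bar>" using that by (simp add: dist_real_def abs_minus_commute)
    then have "x\<^sup>2 < (v - x)\<^sup>2" using abs_le_square_iff[of "v - x" x] by linarith
    then show ?thesis using assms(3) by (simp add: q_def divide_strict_right_mono)
  qed
  have outside: "prox_obj \<rho> g x w < prox_obj \<rho> g x v" if "v \<in> C" "v \<notin> Kp \<union> Kn" for v
  proof (cases "\<bar>v\<bar> < d")
    case True
    then show ?thesis using d(2) q_le[OF that(1)] by force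
  next
    case False
    then have "v \<notin> cball x \<bar>x\<bar>" using that by (auto simp: Kp_def Kn_def)
    then show ?thesis using far[of v] q_le[OF that(1)] w q0 by simp
  qed
  then have wK: "w \<in> Kp \<union> Kn" using w by blast
  have "continuous_on (Kp \<union> Kn) g"
    using K d(1)
    by (intro continuous_on_closed_Un continuous_on_subset[OF contp] continuous_on_subset[OF contn])
      (auto simp: Kp_def Kn_def)
  then have "continuous_on (Kp \<union> Kn) (prox_obj \<rho> g x)"
    unfolding prox_obj_def by (intro continuous_intros) (use assms in auto)
  then obtain v where v: "v \<in> Kp \<union> Kn" "\<And>y. y \<in> Kp \<union> Kn \<Longrightarrow> prox_obj \<rho> g x v \<le> prox_obj \<rho> g x y"
    using continuous_attains_inf[OF K(3)] wK by blast
  have "prox_obj \<rho> g x v \<le> prox_obj \<rho> g x y" if "y \<in> C" for y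
    using v(2)[of y] v(2)[OF wK] outside[OF that] by fastforce
  moreover have "v \<in> C" using v by (auto simp: Kp_def Kn_def)
  ultimately show ?thesis by (auto simp: is_arg_min_linorder)
qed

lemma closed_ebox: "closed (ebox l u)"
proof -
  have "ebox l u = ereal -` {l..u}" by (auto simp: ebox_def)
  then show ?thesis
    by (auto intro!: continuous_closed_vimage simp: continuous_at_of_ereal)
qed

text \<open>A point strictly inside the box and different from \<open>x\<close> can be moved
  slightly towards \<open>x\<close> without leaving the box. Density supplies a real point even if a
  bound is infinite.\<close>

lemma nearest_point_ebox:
  assumes v: "v \<in> ebox l u" and min: "\<And>z. z \<in> ebox l u \<Longrightarrow> (v - x)\<^sup>2 \<le> (z - x)\<^sup>2"
  shows "ereal v = l \<or> ereal v = u \<or> v = x"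
proof (rule ccontr)
  assume neg: "\<not> ?thesis"
  then have lvu: "l < ereal v" "ereal v < u" using v by (auto simp: ebox_def less_le)
  consider "v < x" | "x < v" using neg by force
  then show False
  proof cases
    case 1
    then have "ereal v < min u (ereal x)" using lvu by simp
    then obtain z where z: "ereal v < ereal z" "ereal z < min u (ereal x)"
      using ereal_dense2 by blast
    then have "z \<in> ebox l u" using lvu less_trans[of l "ereal v" "ereal z"] less_trans[of "ereal z" "ereal v" u]
      by (auto simp: ebox_def)
    moreover have "\<bar>z - x\<bar> < \<bar>v - x\<bar>" using z by simp
    ultimately show False using min[of z] abs_le_square_iff[of "v - x" "z - x"] by simp
  next
    case 2
    then have "max l (ereal x) < ereal v" using lvu by simp
    then obtain z where z: "max l (ereal x) < ereal z" "ereal z < ereal v"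
      using ereal_dense2 by blast
    then have "z \<in> ebox l u" using lvu less_trans[of l "ereal v" "ereal z"] less_trans[of "ereal z" "ereal v" u]
      by (auto simp: ebox_def)
    moreover have "\<bar>z - x\<bar> < \<bar>v - x\<bar>" using z by simp
    ultimately show False using min[of z] abs_le_square_iff[of "v - x" "z - x"] by simp
  qed
qed

section \<open>Convexity and smoothness of generating functions\<close>

lemma convex_on_fin_val:
  assumes "strictly_convex \<psi>" "proper_fun \<psi>"
  shows "convex_on (eff_dom \<psi>) (fin_val \<psi>)"
proof (rule convex_on_linorderI)
  show cvx: "convex (eff_dom \<psi>)" using assms by (simp add: strictly_convex_def)
  have fin: "\<psi> z = ereal (fin_val \<psi> z)" if "z \<in> eff_dom \<psi>" for z
    using assms that unfolding proper_fun_def eff_dom_def fin_val_def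
    by (cases "\<psi> z") auto
  fix t x y :: real
  assume t: "t > 0" "t < 1" and xy: "x \<in> eff_dom \<psi>" "y \<in> eff_dom \<psi>" "x < y"
  have "(1 - t) * x + t * y \<in> eff_dom \<psi>"
    using convexD[OF cvx xy(1,2), of "1 - t" t] t by simp
  moreover have "\<psi> ((1 - t) * x + t * y) < ereal (1 - t) * \<psi> x + ereal t * \<psi> y"
    using assms(1) t xy by (auto simp: strictly_convex_def)
  ultimately have "fin_val \<psi> ((1 - t) * x + t * y) < (1 - t) * fin_val \<psi> x + t * fin_val \<psi> y"
    using fin xy by simp
  then show "fin_val \<psi> ((1 - t) *\<^sub>R x + t *\<^sub>R y) \<le> (1 - t) * fin_val \<psi> x + t * fin_val \<psi> y"
    by simp
qed

lemma fin_val_has_derivative: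
  assumes "twice_diff \<psi>" "z \<in> interior (eff_dom \<psi>)"
  shows "(fin_val \<psi> has_real_derivative gderiv \<psi> z) (at z)"
proof -
  have "fin_val \<psi> differentiable (at z)" using assms by (simp add: twice_diff_def)
  then have "(fin_val \<psi> has_vector_derivative vector_derivative (fin_val \<psi>) (at z)) (at z)"
    by (rule vector_derivative_works[THEN iffD1])
  moreover have "gderiv \<psi> z = vector_derivative (fin_val \<psi>) (at z)"
    by (simp only: gderiv_def at_within_interior[OF assms(2)])
  ultimately show ?thesis
    by (simp only: has_real_derivative_iff_has_vector_derivative)
qed

lemma continuous_on_gderiv:
  assumes "twice_diff \<psi>"
  shows "continuous_on (interior (eff_dom \<psi>)) (gderiv \<psi>)"
proof (rule continuous_at_imp_continuous_on, rule ballI)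
  fix z assume "z \<in> interior (eff_dom \<psi>)"
  then show "isCont (gderiv \<psi>) z"
    using assms by (intro differentiable_imp_continuous_within) (simp add: twice_diff_def)
qed

section \<open>The two sides of a generating function as half-line relaxations\<close>

text \<open>Both admissible domains contain \<open>{0..}\<close>, and positive points are interior
  to them, so \<open>\<psi>\<close> itself can serve as \<open>f\<close>.\<close>

lemma half_line_pos:
  assumes "0 < lam0" "l \<le> 0" "0 \<le> u" "generating_fun l u \<psi>" "sublevel_ends lam0 \<psi> \<alpha>m \<alpha>p"
  shows "half_line_relaxation (fin_val \<psi>) (gderiv \<psi>) lam0 (\<kappa>p lam0 \<psi> \<alpha>p u) \<alpha>p u"
proof
  have sub: "{0..} \<subseteq> eff_dom \<psi>" using assms(4) by (auto simp: generating_fun_def)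
  then have int: "{0<..} \<subseteq> interior (eff_dom \<psi>)" by (intro interior_maximal) auto
  have td: "twice_diff \<psi>" using assms(4) by (simp add: generating_fun_def)
  show "convex_on {0..} (fin_val \<psi>)"
    using assms(4) sub
    by (intro convex_on_subset[OF convex_on_fin_val]) (auto simp: generating_fun_def)
  show "(fin_val \<psi> has_real_derivative gderiv \<psi> z) (at z)" if "0 < z" for z
    using fin_val_has_derivative[OF td] int that by auto
  show "continuous_on {0<..} (gderiv \<psi>)"
    by (rule continuous_on_subset[OF continuous_on_gderiv[OF td] int])
  show "fin_val \<psi> 0 - fin_val \<psi> z + gderiv \<psi> z * z \<le> lam0 \<longleftrightarrow> ereal z \<le> \<alpha>p" if "0 < z" for z
  proof -
    have "z \<in> {z \<in> eff_dom \<psi>. bregman \<psi> 0 z \<le> lam0} \<longleftrightarrow> z \<in> ebox \<alpha>m \<alpha>p"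
      using assms(5) by (simp add: sublevel_ends_def)
    moreover have "\<alpha>m \<le> ereal z"
      using assms(5) that by (auto simp: sublevel_ends_def intro: order_trans[of _ 0])
    moreover have "z \<in> eff_dom \<psi>" using sub that by auto
    ultimately show ?thesis by (simp add: bregman_def ebox_def)
  qed
  show "\<kappa>p lam0 \<psi> \<alpha>p u = gderiv \<psi> r" if "\<alpha>p \<le> u" "\<alpha>p = ereal r" for r
    using that by (simp add: \<kappa>p_def gderiv_ext_def)
  show "\<kappa>p lam0 \<psi> \<alpha>p u = L" if "\<alpha>p = \<infinity>" "u = \<infinity>" "(gderiv \<psi> \<longlongrightarrow> L) at_top" for L
  proof -
    have "Lim at_top (gderiv \<psi>) = L" by (intro tendsto_Lim that(3)) simp
    moreover have "\<alpha>p = PInfty" using that(1) by (cases \<alpha>p) auto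
    ultimately show ?thesis using that(2) by (simp add: \<kappa>p_def gderiv_ext_def)
  qed
  show "\<kappa>p lam0 \<psi> \<alpha>p u = (lam0 + fin_val \<psi> r - fin_val \<psi> 0) / r"
    if "u < \<alpha>p" "u = ereal r" for r
    using that(1) unfolding \<kappa>p_def not_le[symmetric] by (simp add: that(2))
  show "0 < lam0" "0 \<le> u" "0 \<le> \<alpha>p" using assms by (simp_all add: sublevel_ends_def)
qed

text \<open>Reflection negates slopes and box ends, hence also \<open>\<kappa>m\<close>, so that the
  linear term keeps its value. The full domain makes every \<open>- z\<close> an interior
  point.\<close>

lemma half_line_neg:
  assumes "0 < lam0" "l < 0" "0 \<le> u" "generating_fun l u \<psi>" "sublevel_ends lam0 \<psi> \<alpha>m \<alpha>p"
    and dom: "eff_dom \<psi> = UNIV"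
  shows "half_line_relaxation (\<lambda>z. fin_val \<psi> (- z)) (\<lambda>z. - gderiv \<psi> (- z)) lam0
    (- \<kappa>m lam0 \<psi> \<alpha>m l) (- \<alpha>m) (- l)"
proof
  have td: "twice_diff \<psi>" using assms(4) by (simp add: generating_fun_def)
  have cvx: "convex_on UNIV (fin_val \<psi>)"
    using assms(4) dom convex_on_fin_val[of \<psi>] by (simp add: generating_fun_def)
  show "convex_on {0..} (\<lambda>z. fin_val \<psi> (- z))"
  proof (rule convex_on_linorderI)
    fix t x y :: real
    assume "t > 0" "t < 1"
    then show "fin_val \<psi> (- ((1 - t) *\<^sub>R x + t *\<^sub>R y)) \<le> (1 - t) * fin_val \<psi> (- x) + t * fin_val \<psi> (- y)"
      using convex_onD[OF cvx, of t "- x" "- y"] by (simp add: algebra_simps)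
  qed simp
  show "((\<lambda>z. fin_val \<psi> (- z)) has_real_derivative - gderiv \<psi> (- z)) (at z)" for z
    using DERIV_mirror[of "fin_val \<psi>" "gderiv \<psi> (- z)" z] fin_val_has_derivative[OF td, of "- z"]
    by (simp add: dom)
  have "continuous_on UNIV (gderiv \<psi>)" using continuous_on_gderiv[OF td] dom by simp
  then have "continuous_on {0<..} (\<lambda>z. gderiv \<psi> (- z))"
    by (rule continuous_on_compose2[of _ _ _ uminus]) (rule continuous_on_minus continuous_on_id subset_UNIV)+
  then show "continuous_on {0<..} (\<lambda>z. - gderiv \<psi> (- z))"
    by (rule continuous_on_minus)
  show "fin_val \<psi> (- 0) - fin_val \<psi> (- z) + - gderiv \<psi> (- z) * z \<le> lam0 \<longleftrightarrow> ereal z \<le> - \<alpha>m"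
    if "0 < z" for z
  proof -
    have "- z \<in> {z \<in> eff_dom \<psi>. bregman \<psi> 0 z \<le> lam0} \<longleftrightarrow> - z \<in> ebox \<alpha>m \<alpha>p"
      using assms(5) by (simp add: sublevel_ends_def)
    moreover have "ereal (- z) \<le> \<alpha>p"
      using assms(5) that by (auto simp: sublevel_ends_def intro: order_trans[of _ 0])
    moreover have "\<alpha>m \<le> ereal (- z) \<longleftrightarrow> ereal z \<le> - \<alpha>m"
      by (cases \<alpha>m) auto
    ultimately show ?thesis by (auto simp: bregman_def ebox_def dom)
  qed
  show "- \<kappa>m lam0 \<psi> \<alpha>m l = - gderiv \<psi> (- r)" if "- \<alpha>m \<le> - l" "- \<alpha>m = ereal r" for r
  proof -
    have "\<alpha>m = ereal (- r)" using that by (cases \<alpha>m) auto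
    moreover have "l \<le> \<alpha>m" using that(1) by (simp only: ereal_minus_le_minus)
    ultimately show ?thesis by (simp add: \<kappa>m_def gderiv_ext_def)
  qed
  show "- \<kappa>m lam0 \<psi> \<alpha>m l = L"
    if "- \<alpha>m = \<infinity>" "- l = \<infinity>" "((\<lambda>z. - gderiv \<psi> (- z)) \<longlongrightarrow> L) at_top" for L
  proof -
    \<comment> \<open>The reflected slope at plus infinity is minus the original slope at minus
      infinity.\<close>
    have "(gderiv \<psi> \<longlongrightarrow> - L) at_bot"
      using tendsto_minus[OF that(3)]
      unfolding minus_minus filterlim_at_bot_mirror[of "gderiv \<psi>"] .
    then have "Lim at_bot (gderiv \<psi>) = - L" by (intro tendsto_Lim) auto
    moreover have "\<alpha>m = MInfty" "l = -\<infinity>" using that by (cases \<alpha>m; cases l; simp)+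
    ultimately show ?thesis by (simp add: \<kappa>m_def gderiv_ext_def)
  qed
  show "- \<kappa>m lam0 \<psi> \<alpha>m l = (lam0 + fin_val \<psi> (- r) - fin_val \<psi> (- 0)) / r"
    if "- l < - \<alpha>m" "- l = ereal r" for r
  proof -
    have "l = ereal (- r)" using that by (cases l) auto
    moreover have "\<not> l \<le> \<alpha>m" using that(1) by (simp only: ereal_minus_less_minus not_le)
    ultimately show ?thesis by (simp add: \<kappa>m_def)
  qed
  show "0 < lam0" "0 \<le> - l" "0 \<le> - \<alpha>m"
    using assms by (simp_all add: sublevel_ends_def)
qed

section \<open>Location of the minimizers\<close>

lemma argmin_in_V_set:
  assumes "0 < lam0" "l \<le> 0" "0 \<le> u" "generating_fun l u \<psi>" "sublevel_ends lam0 \<psi> \<alpha>m \<alpha>p" "0 < \<rho>"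
    and bound: "\<And>z. z \<in> ebox l u \<Longrightarrow> \<beta> lam0 \<psi> \<alpha>m \<alpha>p l u z \<le> lam0"
    and min: "is_arg_min (prox_obj \<rho> (\<beta> lam0 \<psi> \<alpha>m \<alpha>p l u) x) (\<lambda>w. w \<in> ebox l u) v"
  shows "v \<in> V_set \<rho> lam0 \<psi> \<alpha>m \<alpha>p l u x"
proof -
  let ?\<beta> = "\<beta> lam0 \<psi> \<alpha>m \<alpha>p l u"
  let ?F = "fin_val \<psi>"
  have v: "v \<in> ebox l u" and le: "\<And>z. z \<in> ebox l u \<Longrightarrow> prox_obj \<rho> ?\<beta> x v \<le> prox_obj \<rho> ?\<beta> x z"
    using min by (auto simp: is_arg_min_linorder)
  have td: "twice_diff \<psi>" using assms by (simp add: generating_fun_def)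
  \<comment> \<open>Inside an open part of the box the constraint is inactive, so the derivative of
    the objective vanishes at \<open>v\<close>; multiplying by \<open>\<rho>\<close> gives the
    stationarity equation. Leaving \<open>\<kappa>\<close> free covers both signs of
    \<open>v\<close>.\<close>
  have stationary: "v \<in> stat_pts \<rho> \<psi> \<kappa> x"
    if S: "open S" "v \<in> S" "S \<subseteq> ebox l u" "\<And>z. z \<in> S \<Longrightarrow> ?\<beta> z = ?F 0 - ?F z + \<kappa> * z" for S \<kappa>
  proof -
    have dom: "S \<subseteq> eff_dom \<psi>" using S assms(4) by (auto simp: generating_fun_def)
    then have int: "v \<in> interior (eff_dom \<psi>)" using S by (auto simp: interior_def)
    obtain d where d: "0 < d" "ball v d \<subseteq> S" using S(1,2) open_contains_ball by blast
    define h where "h z = ?F 0 - ?F z + \<kappa> * z + 1 / (2 * \<rho>) * (z - x)\<^sup>2" for z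
    have h: "prox_obj \<rho> ?\<beta> x z = h z" if "z \<in> S" for z
      using S(4)[OF that] by (simp add: h_def prox_obj_def)
    have "(h has_real_derivative (- gderiv \<psi> v + \<kappa> + (v - x) / \<rho>)) (at v)"
      unfolding h_def using assms(6)
      by (auto intro!: derivative_eq_intros fin_val_has_derivative[OF td int] simp: field_simps)
    moreover have "\<forall>z. \<bar>v - z\<bar> < d \<longrightarrow> h v \<le> h z"
    proof (intro allI impI)
      fix z assume "\<bar>v - z\<bar> < d"
      then have "z \<in> S" using d by (auto simp: dist_real_def)
      then show "h v \<le> h z" using le[of z] h S by auto
    qed
    ultimately have "- gderiv \<psi> v + \<kappa> + (v - x) / \<rho> = 0"
      using DERIV_local_min d(1) by blast
    then have "v - \<rho> * gderiv \<psi> v = x - \<rho> * \<kappa>"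
      using assms(6) by (simp add: field_simps)
    moreover have "?F differentiable (at v within eff_dom \<psi>)"
      using has_field_derivative_at_within[OF fin_val_has_derivative[OF td int]]
      unfolding real_differentiable_def by blast
    ultimately show ?thesis using int interior_subset by (auto simp: stat_pts_def)
  qed
  have open_between: "open {z. a < ereal z \<and> ereal z < c}" for a c :: ereal
    by (intro open_Collect_conj open_Collect_less continuous_intros)
  consider "v = 0" | "?\<beta> v = lam0" | "0 < v" "ereal v < min \<alpha>p u" | "v < 0" "max \<alpha>m l < ereal v"
    unfolding \<beta>_def by (smt (verit, best))
  then show ?thesis
  proof cases
    case 1
    then show ?thesis by (simp add: V_set_def zero_ereal_def)
  next
    case 2
    \<comment> \<open>No \<open>z\<close> in the box has \<open>\<beta>\<close> above its value
      \<open>lam0\<close> at \<open>v\<close>, so minimality of \<open>v\<close> passes to the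
      quadratic term.\<close>
    have "(v - x)\<^sup>2 \<le> (z - x)\<^sup>2" if "z \<in> ebox l u" for z
    proof -
      have "1 / (2 * \<rho>) * (v - x)\<^sup>2 \<le> 1 / (2 * \<rho>) * (z - x)\<^sup>2"
        using le[OF that] bound[OF that] 2 unfolding prox_obj_def by linarith
      then show ?thesis
        by (rule mult_left_le_imp_le) (use assms(6) in simp)
    qed
    then show ?thesis using nearest_point_ebox[OF v] by (auto simp: V_set_def)
  next
    case 3
    have "v \<in> stat_pts \<rho> \<psi> (\<kappa>p lam0 \<psi> \<alpha>p u) x"
      using 3 assms(2)
      by (intro stationary[OF open_between[of 0 "min \<alpha>p u"]])
        (auto simp: \<beta>_def ebox_def intro: order_trans[of l 0])
    moreover have "u \<noteq> 0" using 3 by auto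
    ultimately show ?thesis by (simp add: V_set_def S_set_def)
  next
    case 4
    have "v \<in> stat_pts \<rho> \<psi> (\<kappa>m lam0 \<psi> \<alpha>m l) x"
      using 4 assms(3)
      by (intro stationary[OF open_between[of "max \<alpha>m l" 0]])
        (auto simp: \<beta>_def ebox_def intro: order_trans[of _ 0 u])
    moreover have "l \<noteq> 0" using 4 by auto
    ultimately show ?thesis by (simp add: V_set_def S_set_def)
  qed
qed

section \<open>Combination of both half-lines\<close>

theorem proposition3:
  fixes lam0 \<rho> :: real and l u :: ereal and N n :: nat
    and \<psi> :: "nat \<Rightarrow> real \<Rightarrow> ereal" and \<alpha>m \<alpha>p :: "nat \<Rightarrow> ereal"
  assumes "lam0 > 0" and "l \<le> 0" and "u \<ge> 0"
    and "\<And>i. i \<in> {1..N} \<Longrightarrow> generating_fun l u (\<psi> i)"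
    and "\<And>i. i \<in> {1..N} \<Longrightarrow> sublevel_ends lam0 (\<psi> i) (\<alpha>m i) (\<alpha>p i)"
    and "\<rho> > 0" and "n \<in> {1..N}"
  shows "\<forall>x. prox \<rho> (\<beta> lam0 (\<psi> n) (\<alpha>m n) (\<alpha>p n) l u) l u x =
    argmin_set (prox_obj \<rho> (\<beta> lam0 (\<psi> n) (\<alpha>m n) (\<alpha>p n) l u) x)
      (ebox l u \<inter> V_set \<rho> lam0 (\<psi> n) (\<alpha>m n) (\<alpha>p n) l u x)"
proof
  fix x
  let ?\<beta> = "\<beta> lam0 (\<psi> n) (\<alpha>m n) (\<alpha>p n) l u"
  have gen: "generating_fun l u (\<psi> n)" and ends: "sublevel_ends lam0 (\<psi> n) (\<alpha>m n) (\<alpha>p n)"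
    using assms by auto
  interpret pos: half_line_relaxation "fin_val (\<psi> n)" "gderiv (\<psi> n)" lam0
    "\<kappa>p lam0 (\<psi> n) (\<alpha>p n) u" "\<alpha>p n" u
    by (rule half_line_pos[OF assms(1-3) gen ends])
  have bp: "?\<beta> z = pos.b z" if "0 < z" for z
    using that by (simp add: \<beta>_def pos.b_def)
  have contp: "continuous_on (ebox l u \<inter> {0<..}) ?\<beta>"
  proof -
    have "continuous_on {0<..} ?\<beta>"
      using pos.continuous_on_b by (rule continuous_on_cong[THEN iffD1, rotated 2]) (auto simp: bp)
    then show ?thesis by (rule continuous_on_subset) auto
  qed
  have neg: "(\<forall>z\<in>ebox l u \<inter> {..<0}. 0 \<le> ?\<beta> z \<and> ?\<beta> z \<le> lam0) \<and>
    continuous_on (ebox l u \<inter> {..<0}) ?\<beta>"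
  proof (cases "ebox l u \<inter> {..<0} = {}")
    case False
    then obtain y where y: "y \<in> ebox l u" "y < 0" by auto
    then have "l < 0" by (auto simp: ebox_def intro: le_less_trans)
    have dom: "eff_dom (\<psi> n) = UNIV"
      using gen y by (auto simp: generating_fun_def)
    interpret neg: half_line_relaxation "\<lambda>z. fin_val (\<psi> n) (- z)" "\<lambda>z. - gderiv (\<psi> n) (- z)" lam0
      "- \<kappa>m lam0 (\<psi> n) (\<alpha>m n) l" "- \<alpha>m n" "- l"
      by (rule half_line_neg[OF assms(1) \<open>l < 0\<close> assms(3) gen ends dom])
    \<comment> \<open>Negation exchanges minimum and maximum of the ends, which matches the test in
      \<open>neg.b\<close> with the one in \<open>\<beta>\<close>.\<close>
    have less_iff: "ereal (- z) < min (- \<alpha>m n) (- l) \<longleftrightarrow> max (\<alpha>m n) l < ereal z" for z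
      by (cases "\<alpha>m n"; cases l) auto
    have bn: "?\<beta> z = neg.b (- z)" if "z < 0" for z
      using that by (simp add: \<beta>_def neg.b_def less_iff del: min_less_iff_conj max_less_iff_conj)
    have "continuous_on {..<0} (\<lambda>z. neg.b (- z))"
      by (rule continuous_on_compose2[OF neg.continuous_on_b]) (auto intro!: continuous_intros)
    then have "continuous_on {..<0} ?\<beta>"
      by (rule continuous_on_cong[THEN iffD1, rotated 2]) (auto simp: bn)
    then have "continuous_on (ebox l u \<inter> {..<0}) ?\<beta>" by (rule continuous_on_subset) auto
    then show ?thesis using neg.b_bounds bn by auto
  qed auto
  have bounds: "0 \<le> ?\<beta> z \<and> ?\<beta> z \<le> lam0" if "z \<in> ebox l u" for z
  proof -
    consider "z = 0" | "0 < z" | "z < 0" by linarith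
    then show ?thesis
      using neg that bp pos.b_bounds assms(1) by cases (auto simp: \<beta>_def[of _ _ _ _ _ _ 0])
  qed
  show "prox \<rho> ?\<beta> l u x = argmin_set (prox_obj \<rho> ?\<beta> x)
      (ebox l u \<inter> V_set \<rho> lam0 (\<psi> n) (\<alpha>m n) (\<alpha>p n) l u x)"
    unfolding prox_def
  proof (rule argmin_set_eq_subset)
    show "v \<in> ebox l u \<inter> V_set \<rho> lam0 (\<psi> n) (\<alpha>m n) (\<alpha>p n) l u x"
      if "is_arg_min (prox_obj \<rho> ?\<beta> x) (\<lambda>w. w \<in> ebox l u) v" for v
      using argmin_in_V_set[OF assms(1-3) gen ends assms(6) _ that] bounds that
      by (auto simp: is_arg_min_def)
    show "\<exists>v. is_arg_min (prox_obj \<rho> ?\<beta> x) (\<lambda>w. w \<in> ebox l u) v"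
      using assms neg contp bounds
      by (intro prox_obj_attains_min closed_ebox)
        (auto simp: ebox_def \<beta>_def[of _ _ _ _ _ _ 0] simp flip: zero_ereal_def)
  qed auto
qed

end
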